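(* For every $b,c>0$ with $bc=3$, the algorithm $\mathrm{Naive}(b,b)$ is the only feasible solution to problem $\mathcal{E}(b,c)$, and is therefore optimal; its total evacuation energy for an instance $d$ is $4b^2d$.
   Context: Two robots start at the origin of the infinite real line. An exit is placed at an unknown point at distance $d>0$ from the origin (either at $d$ or at $-d$; either placement is called an instance $d$). A robot finds the exit if and only if it walks over it. Robots may change speed and direction at any time, and communicate wirelessly: messages are transmitted instantaneously at any distance. The evacuation time is the time at which the last robot reaches the exit. A robot moving at constant speed $s$ over a segment of length $x$ uses energy $xs^2$; more generally, moving in one direction from $a$ to $b$ with speed $s(x)$ at position $x$ uses energy $\int_a^b s(x)^2\,dx$, and energies of successive intervals add up. The total evacuation energy is the sum of the two robots' energies used until both have reached the exit. Problem $\mathcal{E}(b,c)$: minimize the total evacuation energy over algorithms using speeds at most $b$ whose evacuation time is at most $cd$ for every instance $d$ (such algorithms are the feasible solutions). Algorithm $\mathrm{Naive}(s,r)$: the two robots move in opposite directions with speed $s$ until the exit is found; the finder announces "exit found" and halts; the other robot turns around and moves at speed $r$ until it reaches the exit.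
   Formalization: Uniqueness is proved up to naming of the robots and for each robot's motion until it reaches the exit (for all time if robots halt there); a finder that wanders after announcing the exit is also feasible, so the literal "only feasible solution" fails. *)

theory Defs
  imports "HOL-Analysis.Analysis" "HOL-Library.Extended_Nonnegative_Real"
begin

datatype robot = Robot1 | Robot2

text \<open>\<open>A e i t\<close> is the position at time \<open>t \<ge> 0\<close> of robot \<open>i\<close> when the exit is at \<open>e\<close>. The instance
  \<open>d > 0\<close> stands for the two placements \<open>e = d\<close> and \<open>e = -d\<close>; \<open>e = 0\<close> and \<open>t < 0\<close> carry no meaning.\<close>

type_synonym algorithm = "real \<Rightarrow> robot \<Rightarrow> real \<Rightarrow> real"

definition found_before :: "algorithm \<Rightarrow> real \<Rightarrow> real \<Rightarrow> bool" where
  "found_before A e t \<longleftrightarrow> (\<exists>i. \<exists>\<tau>\<in>{0..<t}. A e i \<tau> = e)"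

text \<open>The last condition expresses that the location of the exit is unknown until some robot walks
  over it: as long as the exit has been found neither in placement \<open>e\<close> nor in placement \<open>e'\<close>, the
  robots behave identically in both. Since messages are instantaneous, after the discovery both
  robots may use the location of the exit in an arbitrary way.\<close>

definition is_algorithm :: "algorithm \<Rightarrow> bool" where
  "is_algorithm A \<longleftrightarrow>
     (\<forall>e i. e \<noteq> 0 \<longrightarrow> A e i 0 = 0 \<and> continuous_on {0..} (A e i)) \<and>
     (\<forall>e e' t. e \<noteq> 0 \<and> e' \<noteq> 0 \<and> 0 \<le> t \<and> \<not> found_before A e t \<and> \<not> found_before A e' t
        \<longrightarrow> (\<forall>i. A e i t = A e' i t))"

definition speed_at_most :: "real \<Rightarrow> algorithm \<Rightarrow> bool" where
  "speed_at_most b A \<longleftrightarrow> (\<forall>e i. e \<noteq> 0 \<longrightarrow> b-lipschitz_on {0..} (A e i))"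

definition reaches_exit :: "algorithm \<Rightarrow> real \<Rightarrow> robot \<Rightarrow> bool" where
  "reaches_exit A e i \<longleftrightarrow> (\<exists>t\<ge>0. A e i t = e)"

text \<open>Only meaningful if the robot reaches the exit; the infimum is then attained by continuity.\<close>

definition arrival_time :: "algorithm \<Rightarrow> real \<Rightarrow> robot \<Rightarrow> real" where
  "arrival_time A e i = Inf {t. 0 \<le> t \<and> A e i t = e}"

definition evac_time :: "algorithm \<Rightarrow> real \<Rightarrow> real" where
  "evac_time A e = max (arrival_time A e Robot1) (arrival_time A e Robot2)"

text \<open>\<open>uses_energy x u v E\<close>: the motion \<open>x\<close> uses energy \<open>E\<close> in the time interval from \<open>u\<close> to \<open>v\<close>. In
  \<open>move\<close>, \<open>s p\<close> is the speed at position \<open>p\<close>, and the integral is taken over positions, not over time;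
  \<open>\<sigma>\<close> is the direction of the motion. Points where the speed jumps or vanishes are handled by
  splitting the interval with \<open>add\<close>.\<close>

inductive uses_energy :: "(real \<Rightarrow> real) \<Rightarrow> real \<Rightarrow> real \<Rightarrow> real \<Rightarrow> bool" for x :: "real \<Rightarrow> real" where
  rest: "\<lbrakk> u \<le> v; \<forall>t\<in>{u..v}. x t = x u \<rbrakk> \<Longrightarrow> uses_energy x u v 0"
| move: "\<lbrakk> u < v; continuous_on {u..v} x; \<sigma> \<in> {1, -1};
           \<forall>t\<in>{u<..<v}. 0 < s (x t) \<and> (x has_real_derivative \<sigma> * s (x t)) (at t);
           ((\<lambda>p. (s p)\<^sup>2) has_integral E) {min (x u) (x v)..max (x u) (x v)} \<rbrakk>
         \<Longrightarrow> uses_energy x u v E"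
| add: "\<lbrakk> uses_energy x u v E; uses_energy x v w F \<rbrakk> \<Longrightarrow> uses_energy x u w (E + F)"

text \<open>The energy does not depend on the chosen decomposition, so the infimum merely selects its value.
  A motion that is no finite succession of rests and one-directional moves gets energy \<open>\<infinity>\<close>.\<close>

definition energy :: "(real \<Rightarrow> real) \<Rightarrow> real \<Rightarrow> real \<Rightarrow> ennreal" where
  "energy x u v = Inf {ennreal E | E. uses_energy x u v E}"

definition evac_energy :: "algorithm \<Rightarrow> real \<Rightarrow> ennreal" where
  "evac_energy A e =
     energy (A e Robot1) 0 (evac_time A e) + energy (A e Robot2) 0 (evac_time A e)"

definition feasible :: "real \<Rightarrow> real \<Rightarrow> algorithm \<Rightarrow> bool" where
  "feasible b c A \<longleftrightarrow>
     is_algorithm A \<and> speed_at_most b A \<and>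
     (\<forall>d>0. \<forall>e\<in>{d, -d}. (\<forall>i. reaches_exit A e i) \<and> evac_time A e \<le> c * d)"

definition optimal :: "real \<Rightarrow> real \<Rightarrow> algorithm \<Rightarrow> bool" where
  "optimal b c A \<longleftrightarrow>
     feasible b c A \<and>
     (\<forall>B. feasible b c B \<longrightarrow> (\<forall>d>0. \<forall>e\<in>{d, -d}. evac_energy A e \<le> evac_energy B e))"

text \<open>The initial direction of each robot, where \<open>\<sigma> \<in> {1, -1}\<close> is that of the first one.\<close>

fun direction :: "real \<Rightarrow> robot \<Rightarrow> real" where
  "direction \<sigma> Robot1 = \<sigma>"
| "direction \<sigma> Robot2 = - \<sigma>"

text \<open>The exit is found at time \<open>\<bar>e\<bar> / s\<close>, when the other robot is at \<open>-e\<close>.\<close>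

definition naive :: "real \<Rightarrow> real \<Rightarrow> real \<Rightarrow> algorithm" where
  "naive \<sigma> s r e i t =
     (if t \<le> \<bar>e\<bar> / s then direction \<sigma> i * s * t
      else if direction \<sigma> i = sgn e then e
      else if r * (t - \<bar>e\<bar> / s) \<le> 2 * \<bar>e\<bar> then - e + sgn e * r * (t - \<bar>e\<bar> / s)
      else e)"

definition same_until_exit :: "algorithm \<Rightarrow> algorithm \<Rightarrow> bool" where
  "same_until_exit A B \<longleftrightarrow>
     (\<forall>e i. e \<noteq> 0 \<longrightarrow>
        arrival_time A e i = arrival_time B e i \<and> (\<forall>t\<in>{0..arrival_time A e i}. A e i t = B e i t))"

definition halts_at_exit :: "algorithm \<Rightarrow> bool" where
  "halts_at_exit A \<longleftrightarrow> (\<forall>e i t. e \<noteq> 0 \<and> reaches_exit A e i \<and> arrival_time A e i \<le> t \<longrightarrow> A e i t = e)"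

end

theory Submission
  imports Defs
begin

text \<open>
  A robot can visit both \<open>d\<close> and \<open>-d\<close> no earlier than at time \<open>3 d / b = c d\<close>, and then only by
  moving at full speed all the time. Whichever of the two points is discovered first, its discoverer
  must reach the other one in time if the exit is there; hence for every \<open>d\<close> some robot is at
  distance \<open>d\<close> at time \<open>d / b\<close>, so one robot runs away in a fixed direction at speed \<open>b\<close> as long as
  nothing is found. It can return to an exit on the other side in time only if the other robot
  finds that exit at time \<open>d / b\<close>, which forces the other robot to run in the opposite direction at
  speed \<open>b\<close>. After the discovery, the remaining distance \<open>2 d\<close> again leaves no slack.

  Energy is additive under splitting the time interval, so a feasible algorithm uses at least the
  energy of the forced parts of its motion, namely \<open>b\<^sup>2 d\<close> and \<open>3 b\<^sup>2 d\<close>.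
\<close>

section \<open>Motions of maximal speed\<close>

text \<open>From \<open>p\<close> to \<open>q\<close> the displacement is the largest that the
  Lipschitz bound allows, so a shortfall before \<open>t\<close> could not be made up after it. This
  rigidity turns tight time bounds into exact trajectories.\<close>

lemma lipschitz_straight:
  fixes f :: "real \<Rightarrow> real"
  assumes lip: "b-lipschitz_on {0..} f" and "0 \<le> p" "p \<le> t" "t \<le> q"
    and "\<rho> \<in> {1, -1}" and "f q - f p = \<rho> * b * (q - p)"
  shows "f t = f p + \<rho> * b * (t - p)"
proof -
  have "\<bar>f t - f p\<bar> \<le> b * (t - p)" "\<bar>f q - f t\<bar> \<le> b * (q - t)"
    using lipschitz_onD[OF lip, of t p] lipschitz_onD[OF lip, of q t] assms
    by (auto simp: dist_real_def)
  then show ?thesis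
    using assms(5,6) by (auto simp: algebra_simps)
qed

section \<open>Energy\<close>

lemma uses_energy_le: "uses_energy x u v E \<Longrightarrow> u \<le> v"
  by (induction rule: uses_energy.induct) auto

lemma uses_energy_nonneg: "uses_energy x u v E \<Longrightarrow> 0 \<le> E"
  by (induction rule: uses_energy.induct) (auto intro: has_integral_nonneg)

lemma strict_increase_of_move:
  fixes x s :: "real \<Rightarrow> real"
  assumes "u < v" "continuous_on {u..v} x" "\<sigma> \<in> {1, -1}"
    and der: "\<forall>t\<in>{u<..<v}. 0 < s (x t) \<and> (x has_real_derivative \<sigma> * s (x t)) (at t)"
  shows "\<sigma> * x u < \<sigma> * x v"
proof (rule DERIV_pos_imp_increasing_open[OF \<open>u < v\<close>])
  show "\<exists>y. ((\<lambda>t. \<sigma> * x t) has_real_derivative y) (at t) \<and> 0 < y" if "u < t" "t < v" for t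
  proof (intro exI conjI)
    show "((\<lambda>t. \<sigma> * x t) has_real_derivative \<sigma> * (\<sigma> * s (x t))) (at t)"
      using der that by (auto intro!: DERIV_cmult)
    show "0 < \<sigma> * (\<sigma> * s (x t))"
      using der that assms(3) by auto
  qed
  show "continuous_on {u..v} (\<lambda>t. \<sigma> * x t)"
    using assms(2) by (intro continuous_intros)
qed

text \<open>Cutting a rest or a move gives pieces of the same kind, and a cut through a
  concatenation hits one component. The split is exact, so the forced phases of a motion can be
  charged separately.\<close>

lemma uses_energy_split:
  assumes "uses_energy x u w E" "u \<le> v" "v \<le> w"
  shows "\<exists>F G. uses_energy x u v F \<and> uses_energy x v w G \<and> E = F + G"
  using assms
proof (induction arbitrary: v rule: uses_energy.induct)
  case (rest u w)
  show ?case
  proof (intro exI conjI)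
    have const: "x t = x u" if "u \<le> t" "t \<le> w" for t
      using rest.hyps(2) that by (metis atLeastAtMost_iff)
    show "uses_energy x u v 0"
      by (rule uses_energy.rest[OF rest.prems(1)])
        (metis const atLeastAtMost_iff order_trans rest.prems(2))
    show "uses_energy x v w 0"
      by (rule uses_energy.rest[OF rest.prems(2)])
        (metis const atLeastAtMost_iff order_trans rest.prems)
  qed simp
next
  case (move u w \<sigma> s E)
  \<comment> \<open>\<open>move\<close> needs an interval of positive length; a cut at an end is
    completed by a rest of length zero.\<close>
  consider "v = u" | "v = w" | "u < v" "v < w"
    using move by linarith
  then show ?case
  proof cases
    case 1
    show ?thesis
    proof (intro exI conjI)
      show "uses_energy x u v 0"
        unfolding 1 by (rule uses_energy.rest) auto
      show "uses_energy x v w E"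
        unfolding 1 by (rule uses_energy.move[OF move.hyps])
    qed simp
  next
    case 2
    show ?thesis
    proof (intro exI conjI)
      show "uses_energy x u v E"
        unfolding 2 by (rule uses_energy.move[OF move.hyps])
      show "uses_energy x v w 0"
        unfolding 2 by (rule uses_energy.rest) auto
    qed simp
  next
    case 3
    have cont: "continuous_on {u..v} x" "continuous_on {v..w} x"
      using move(2) 3 by (auto intro: continuous_on_subset)
    have ord: "\<sigma> * x u < \<sigma> * x v" "\<sigma> * x v < \<sigma> * x w"
      using 3 move.hyps(3,4) cont
      by (intro strict_increase_of_move[where s = s]; simp)+
    let ?f = "\<lambda>p. (s p)\<^sup>2"
    let ?l = "min (x u) (x w)" and ?r = "max (x u) (x w)"
    have mid: "?l \<le> x v" "x v \<le> ?r"
      using ord move(3) by auto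
    have int: "?f integrable_on {?l..?r}" and E: "E = integral {?l..?r} ?f"
      using move(5) by (auto simp: integral_unique)
    have int1: "?f integrable_on {?l..x v}" and int2: "?f integrable_on {x v..?r}"
      using int mid by (auto intro: integrable_subinterval_real)
    have sum: "integral {?l..x v} ?f + integral {x v..?r} ?f = E"
      unfolding E using mid int by (rule Henstock_Kurzweil_Integration.integral_combine)
    \<comment> \<open>The integral runs over positions: for \<sigma> = 1 the motion before
      \<open>v\<close> covers the left part of the interval, for \<sigma> = -1 the right
      part.\<close>
    obtain F G where F: "(?f has_integral F) {min (x u) (x v)..max (x u) (x v)}"
      and G: "(?f has_integral G) {min (x v) (x w)..max (x v) (x w)}" and FG: "E = F + G"
    proof (cases "\<sigma> = 1")
      case True
      with ord int1 int2 sum show ?thesis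
        by (intro that[of "integral {?l..x v} ?f" "integral {x v..?r} ?f"])
          (auto simp: min_def max_def)
    next
      case False
      with ord move(3) int1 int2 sum show ?thesis
        by (intro that[of "integral {x v..?r} ?f" "integral {?l..x v} ?f"])
          (auto simp: min_def max_def)
    qed
    show ?thesis
    proof (intro exI conjI)
      show "uses_energy x u v F"
        using 3 move(3,4) cont F by (intro uses_energy.move[where s = s and \<sigma> = \<sigma>]) auto
      show "uses_energy x v w G"
        using 3 move(3,4) cont G by (intro uses_energy.move[where s = s and \<sigma> = \<sigma>]) auto
    qed (rule FG)
  qed
next
  case (add u m E w F)
  show ?case
  proof (cases "v \<le> m")
    case True
    obtain F1 G1 where "uses_energy x u v F1" "uses_energy x v m G1" "E = F1 + G1"
      using add.IH(1)[OF add.prems(1) True] by blast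
    moreover from this have "uses_energy x v w (G1 + F)"
      using add.hyps uses_energy.add by blast
    ultimately show ?thesis
      by (metis ab_semigroup_add_class.add_ac(1))
  next
    case False
    then obtain F1 G1 where "uses_energy x m v F1" "uses_energy x v w G1" "F = F1 + G1"
      using add.IH(2)[of v] add.prems(2) by auto
    moreover from this have "uses_energy x u v (E + F1)"
      using add.hyps uses_energy.add by blast
    ultimately show ?thesis
      by (metis ab_semigroup_add_class.add_ac(1))
  qed
qed

text \<open>Uniqueness of the derivative forces the speed function of every move to equal
  \<open>b\<close>, and a rest of positive length is impossible. Hence every decomposition yields
  the same value.\<close>

lemma uses_energy_affine_unique:
  assumes "uses_energy x u v E" "b > 0" "\<rho> \<in> {1, -1}"
    and "\<forall>t\<in>{u..v}. x t = a + \<rho> * b * t"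
  shows "E = b\<^sup>2 * (b * (v - u))"
  using assms
proof (induction rule: uses_energy.induct)
  case (rest u v)
  then have "x v = x u" "x v = a + \<rho> * b * v" "x u = a + \<rho> * b * u"
    by auto
  with rest show ?case by auto
next
  case (move u v \<sigma> s E)
  let ?l = "min (x u) (x v)" and ?r = "max (x u) (x v)"
  have xu: "x u = a + \<rho> * b * u" and xv: "x v = a + \<rho> * b * v"
    using move by auto
  have s: "s (x t) = b" if t: "t \<in> {u<..<v}" for t
  proof -
    have "((\<lambda>t. a + \<rho> * b * t) has_real_derivative \<rho> * b) (at t)"
      by (auto intro!: derivative_eq_intros)
    then have "(x has_real_derivative \<rho> * b) (at t)"
    proof (rule has_field_derivative_transform_within_open)
      show "open {u<..<v}" "t \<in> {u<..<v}"
        using t by auto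
    qed (use move in auto)
    moreover have "(x has_real_derivative \<sigma> * s (x t)) (at t)" "0 < s (x t)"
      using move t by auto
    ultimately have "\<sigma> * s (x t) = \<rho> * b"
      by (blast intro: DERIV_unique)
    then show ?thesis
      using \<open>0 < s (x t)\<close> move by auto
  qed
  \<comment> \<open>A move determines \<open>s\<close> only at positions taken at interior times;
    the values at the two end positions do not affect the integral.\<close>
  have "(s p)\<^sup>2 = b\<^sup>2" if p: "p \<in> {?l..?r} - {?l, ?r}" for p
  proof -
    \<comment> \<open>This inverts the affine motion, using that \<rho> is its own
      reciprocal.\<close>
    define t where "t = \<rho> * (p - a) / b"
    have "p = a + \<rho> * b * t"
      using move.prems by (auto simp: t_def)
    moreover have "?l < p" "p < ?r"
      using p by auto
    ultimately have "t \<in> {u<..<v}"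
      using move.prems(1,2) \<open>u < v\<close> xu xv by (auto simp: min_def max_def split: if_splits)
    moreover from this have "x t = p"
      using move.prems(3) \<open>p = _\<close> by auto
    ultimately show ?thesis using s by auto
  qed
  then have "((\<lambda>p. b\<^sup>2) has_integral E) {?l..?r}"
    by (intro has_integral_spike_finite[OF _ _ move.hyps(5), of "{?l, ?r}"]) auto
  moreover have "((\<lambda>p. b\<^sup>2) has_integral b\<^sup>2 * (?r - ?l)) {?l..?r}"
    using has_integral_const_real[of "b\<^sup>2" ?l ?r]
    by (simp add: mult.commute content_real min.coboundedI1)
  ultimately have "E = b\<^sup>2 * (?r - ?l)"
    by (rule has_integral_unique)
  moreover have "b * u < b * v"
    using move by simp
  then have "?r - ?l = b * (v - u)"
    using move.prems(2) unfolding xu xv by (auto simp: algebra_simps min_def max_def)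
  ultimately show ?case by simp
next
  case (add u v E w F)
  then have "u \<le> v" "v \<le> w"
    using uses_energy_le by blast+
  with add show ?case by (auto simp: algebra_simps)
qed

lemma uses_energy_affine:
  assumes "u \<le> v" "b > 0" "\<rho> \<in> {1, -1}" and x: "\<forall>t\<in>{u..v}. x t = a + \<rho> * b * t"
  shows "uses_energy x u v (b\<^sup>2 * (b * (v - u)))"
proof (cases "u = v")
  case True
  then show ?thesis using uses_energy.rest[of u u x] by simp
next
  case False
  then have "u < v" using assms by simp
  show ?thesis
  proof (rule uses_energy.move[where \<sigma> = \<rho> and s = "\<lambda>_. b"])
    have "continuous_on {u..v} (\<lambda>t. a + \<rho> * b * t)"
      by (intro continuous_intros)
    then show "continuous_on {u..v} x"
      using x by (subst continuous_on_cong[OF refl]) auto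
    have "(x has_real_derivative \<rho> * b) (at t)" if t: "t \<in> {u<..<v}" for t
    proof (rule has_field_derivative_transform_within_open)
      show "((\<lambda>t. a + \<rho> * b * t) has_real_derivative \<rho> * b) (at t)"
        by (auto intro!: derivative_eq_intros)
      show "open {u<..<v}" "t \<in> {u<..<v}"
        using t by auto
    qed (use x in auto)
    then show "\<forall>t\<in>{u<..<v}. 0 < b \<and> (x has_real_derivative \<rho> * b) (at t)"
      using \<open>b > 0\<close> by blast
    have "b * u < b * v"
      using assms \<open>u < v\<close> by simp
    then have "max (x u) (x v) - min (x u) (x v) = b * (v - u)"
      using assms \<open>u < v\<close> by (auto simp: algebra_simps min_def max_def)
    moreover have "min (x u) (x v) \<le> max (x u) (x v)"
      by simp
    ultimately show "((\<lambda>p. b\<^sup>2) has_integral b\<^sup>2 * (b * (v - u)))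
        {min (x u) (x v)..max (x u) (x v)}"
      using has_integral_const_real[of "b\<^sup>2" "min (x u) (x v)" "max (x u) (x v)"]
      by (simp only: content_real real_scaleR_def) (simp add: mult.commute)
  qed (use \<open>u < v\<close> assms in auto)
qed

section \<open>Feasible algorithms\<close>

lemma direction_cases: "\<sigma> \<in> {1, -1} \<Longrightarrow> direction \<sigma> i \<in> {1, -1}"
  by (cases i) auto

lemma direction_opposite:
  "\<sigma> \<in> {1, -1} \<Longrightarrow> e \<noteq> 0 \<Longrightarrow> direction \<sigma> Robot2 = sgn e \<longleftrightarrow> direction \<sigma> Robot1 \<noteq> sgn e"
  by (auto simp: sgn_if split: if_splits)

text \<open>\<open>A\<close> is an arbitrary feasible algorithm. The locale is also interpreted with
  the naive algorithm itself, whose evacuation and arrival times are thereby obtained from the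
  general results.\<close>

locale tight_feasible =
  fixes b c :: real and A :: algorithm
  assumes b: "b > 0" and bc: "b * c = 3" and feasible: "feasible b c A"
begin

lemma start: "e \<noteq> 0 \<Longrightarrow> A e i 0 = 0"
  using feasible by (auto simp: feasible_def is_algorithm_def)

lemma continuous: "e \<noteq> 0 \<Longrightarrow> continuous_on {0..} (A e i)"
  using feasible by (auto simp: feasible_def is_algorithm_def)

lemma lipschitz: "e \<noteq> 0 \<Longrightarrow> b-lipschitz_on {0..} (A e i)"
  using feasible by (auto simp: feasible_def speed_at_most_def)

lemma indistinguishable:
  "e \<noteq> 0 \<Longrightarrow> e' \<noteq> 0 \<Longrightarrow> 0 \<le> t \<Longrightarrow> \<not> found_before A e t \<Longrightarrow> \<not> found_before A e' t
    \<Longrightarrow> A e i t = A e' i t"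
  using feasible unfolding feasible_def is_algorithm_def by blast

lemma distance_le:
  "e \<noteq> 0 \<Longrightarrow> 0 \<le> s \<Longrightarrow> s \<le> t \<Longrightarrow> \<bar>A e i t - A e i s\<bar> \<le> b * (t - s)"
  using lipschitz_onD[OF lipschitz, of e t s i] by (auto simp: dist_real_def)

lemma
  assumes "e \<noteq> 0"
  shows reaches: "reaches_exit A e i" and evac_time_le: "evac_time A e \<le> c * \<bar>e\<bar>"
proof -
  have "\<bar>e\<bar> > 0" "e \<in> {\<bar>e\<bar>, - \<bar>e\<bar>}"
    using assms by auto
  then show "reaches_exit A e i" "evac_time A e \<le> c * \<bar>e\<bar>"
    using feasible unfolding feasible_def by blast+
qed

lemma arrival_le:
  assumes "e \<noteq> 0"
  shows "b * arrival_time A e i \<le> 3 * \<bar>e\<bar>"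
proof -
  have "arrival_time A e i \<le> c * \<bar>e\<bar>"
    using evac_time_le[OF assms] by (cases i) (auto simp: evac_time_def)
  then have "b * arrival_time A e i \<le> b * (c * \<bar>e\<bar>)"
    using b by simp
  then show ?thesis
    using bc by (simp flip: mult.assoc)
qed

lemma arrival_attained:
  assumes "e \<noteq> 0"
  shows "0 \<le> arrival_time A e i" "A e i (arrival_time A e i) = e"
proof -
  let ?S = "{t. 0 \<le> t \<and> A e i t = e}"
  have "?S = {0..} \<inter> A e i -` {e}" by auto
  then have "closed ?S"
    using continuous_closed_preimage[OF continuous[OF assms], of "{e}"] by simp
  moreover have "?S \<noteq> {}"
    using reaches[OF assms, of i] by (auto simp: reaches_exit_def)
  moreover have "bdd_below ?S"
    by (auto intro!: bdd_belowI[of _ 0])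
  ultimately have "Inf ?S \<in> ?S"
    by (intro closed_contains_Inf)
  then show "0 \<le> arrival_time A e i" "A e i (arrival_time A e i) = e"
    by (auto simp: arrival_time_def)
qed

lemma arrival_lower: "0 \<le> t \<Longrightarrow> A e i t = e \<Longrightarrow> arrival_time A e i \<le> t"
  unfolding arrival_time_def by (rule cInf_lower) (auto intro!: bdd_belowI[of _ 0])

lemma arrival_ge: "e \<noteq> 0 \<Longrightarrow> \<bar>e\<bar> \<le> b * arrival_time A e i"
  using distance_le[of e 0 "arrival_time A e i" i] arrival_attained[of e i] start[of e i] by simp

text \<open>\<open>found_before\<close> considers only times strictly before \<open>t\<close>, so
  equality in the second hypothesis is harmless.\<close>

lemma not_found_early:
  assumes "e \<noteq> 0" "b * t \<le> \<bar>e\<bar>"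
  shows "\<not> found_before A e t"
proof
  assume "found_before A e t"
  then obtain i \<tau> where \<tau>: "0 \<le> \<tau>" "\<tau> < t" "A e i \<tau> = e"
    by (auto simp: found_before_def)
  then have "\<bar>e\<bar> \<le> b * \<tau>"
    using distance_le[of e 0 \<tau> i] start[of e i] assms by simp
  moreover have "b * \<tau> < b * t"
    using b \<tau> by simp
  ultimately show False using assms by linarith
qed

text \<open>The motion of the robots as long as no exit is found: at time \<open>t\<close> an exit beyond distance
  \<open>b t\<close> is still out of reach.\<close>

definition search :: "robot \<Rightarrow> real \<Rightarrow> real" where
  "search i t = A (b * t + 1) i t"

lemma eq_search:
  assumes "e \<noteq> 0" "0 \<le> t" "\<not> found_before A e t"
  shows "A e i t = search i t"
proof -
  have "0 \<le> b * t" using assms b by simp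
  then show ?thesis
    unfolding search_def using assms by (intro indistinguishable not_found_early[of "b * t + 1"]) auto
qed

lemma search_start: "search i 0 = 0"
  by (simp add: search_def start)

text \<open>\<open>search\<close> refers to a different exit at each time. Two times are compared
  through a single exit that is out of reach until the later of them.\<close>

lemma search_lipschitz: "b-lipschitz_on {0..} (search i)"
proof (rule lipschitz_onI)
  fix s t :: real
  assume st: "s \<in> {0..}" "t \<in> {0..}"
  define e where "e = b * max s t + 1"
  have "b * s \<le> b * max s t" "b * t \<le> b * max s t" "0 \<le> b * max s t"
    using b st by auto
  then have "e \<noteq> 0" "b * s \<le> \<bar>e\<bar>" "b * t \<le> \<bar>e\<bar>"
    by (auto simp: e_def)
  then have "search i s = A e i s" "search i t = A e i t"
    using st not_found_early by (auto intro!: eq_search[symmetric])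
  then show "dist (search i s) (search i t) \<le> b * dist s t"
    using lipschitz_onD[OF lipschitz] \<open>e \<noteq> 0\<close> st by simp
qed (use b in simp)

section \<open>The time of discovery and the motion of the robots before it\<close>

definition discovery :: "real \<Rightarrow> real" where
  "discovery e = min (arrival_time A e Robot1) (arrival_time A e Robot2)"

lemma discovery_le: "discovery e \<le> arrival_time A e i"
  by (cases i) (auto simp: discovery_def)

lemma discovery_finder: obtains i where "arrival_time A e i = discovery e"
  by (metis discovery_def min_def)

lemma discovery_bounds:
  assumes "e \<noteq> 0"
  shows "0 \<le> discovery e" "\<bar>e\<bar> \<le> b * discovery e"
  by (metis discovery_finder arrival_attained(1) arrival_ge assms)+

text \<open>The moment of discovery is included because \<open>found_before\<close> is strict. Thus
  the finder stands on the exit in the search motion as well.\<close>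

lemma eq_search_until_discovery:
  assumes "e \<noteq> 0" "0 \<le> t" "t \<le> discovery e"
  shows "A e i t = search i t"
proof -
  have "\<not> found_before A e t"
  proof
    assume "found_before A e t"
    then obtain i \<tau> where "0 \<le> \<tau>" "\<tau> < t" "A e i \<tau> = e"
      by (auto simp: found_before_def)
    then show False
      using arrival_lower[of \<tau> e i] discovery_le[of e i] assms by linarith
  qed
  then show ?thesis using eq_search assms by blast
qed

text \<open>Of the exits \<open>e\<close> and \<open>-e\<close> let \<open>-e\<close> be the one discovered first. Its finder still has to cross
  the distance \<open>2 d\<close> if the exit is at \<open>e\<close>, which leaves only time \<open>d / b\<close> for the discovery.\<close>

lemma search_extreme:
  assumes "d > 0"
  shows "\<exists>k. \<exists>\<rho>\<in>{1, -1}. search k (d / b) = \<rho> * d"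
proof -
  obtain \<rho> where \<rho>: "\<rho> \<in> {1, -1}" and le: "discovery (\<rho> * d) \<le> discovery (- (\<rho> * d))"
  proof (cases "discovery d \<le> discovery (- d)")
    case True
    with that[of 1] show ?thesis by simp
  next
    case False
    with that[of "-1"] show ?thesis by simp
  qed
  define e where "e = - (\<rho> * d)"
  have e: "e \<noteq> 0" "-e \<noteq> 0" "\<bar>e\<bar> = d" and \<rho>d: "\<rho> * d = -e"
    using \<rho> assms by (auto simp: e_def)
  define \<tau> where "\<tau> = discovery (-e)"
  obtain k where k: "arrival_time A (-e) k = \<tau>"
    unfolding \<tau>_def by (rule discovery_finder)
  have \<tau>: "0 \<le> \<tau>" "d \<le> b * \<tau>" "\<tau> \<le> discovery e"
    using discovery_bounds[of "-e"] e le by (auto simp: \<tau>_def e_def)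
  have sk: "search k \<tau> = -e"
    using eq_search_until_discovery[of "-e" \<tau> k] arrival_attained(2)[of "-e" k] e \<tau> k
    by (simp add: \<tau>_def)
  \<comment> \<open>At time \<tau> the exit \<open>e\<close> is not discovered earlier either, so
    robot \<open>k\<close> is at \<open>-e\<close> in that run too and still has
    \<open>2 * d\<close> to go.\<close>
  then have "A e k \<tau> = -e"
    using eq_search_until_discovery e \<tau> by simp
  moreover have "\<tau> \<le> arrival_time A e k"
    using \<tau> discovery_le[of e k] by linarith
  ultimately have "2 * d \<le> b * (arrival_time A e k - \<tau>)"
    using distance_le[of e \<tau> "arrival_time A e k" k] arrival_attained(2)[of e k] e \<tau> by auto
  then have "b * \<tau> \<le> d"
    using arrival_le[of e k] e by (simp add: algebra_simps)
  then have "\<tau> = d / b"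
    using \<tau> b by (simp add: field_simps)
  then show ?thesis
    using sk \<rho> \<rho>d by metis
qed

lemma search_straight:
  assumes "search k (d / b) = \<rho> * d" "\<rho> \<in> {1, -1}" "0 \<le> t" "b * t \<le> d"
  shows "search k t = \<rho> * b * t"
proof -
  have "t \<le> d / b"
    using assms b by (simp add: field_simps)
  moreover have "search k (d / b) - search k 0 = \<rho> * b * (d / b - 0)"
    using assms b by (simp add: search_start)
  ultimately show ?thesis
    using lipschitz_straight[OF search_lipschitz, of 0 t "d / b" \<rho> k] assms
    by (simp add: search_start)
qed

text \<open>The robot and direction given by \<open>search_extreme\<close> may depend on
  \<open>d\<close>, but there are only four pairs. If each pair failed at some time, the pair
  extreme at a horizon beyond all four times would contradict
  \<open>search_straight\<close>.\<close>

lemma search_eternal_robot: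
  "\<exists>k. \<exists>\<rho>\<in>{1, -1}. \<forall>t\<ge>0. search k t = \<rho> * b * t"
proof (rule ccontr)
  assume "\<not> ?thesis"
  then have "\<forall>k. \<forall>\<rho>\<in>{1, -1}. \<exists>t\<ge>0. search k t \<noteq> \<rho> * b * t"
    by blast
  then obtain T where T: "\<And>k \<rho>. \<rho> \<in> {1, -1} \<Longrightarrow> 0 \<le> T k \<rho> \<and> search k (T k \<rho>) \<noteq> \<rho> * b * T k \<rho>"
    by metis
  \<comment> \<open>A sum of nonnegative failure times dominates each of them; the summand 1 makes
    the horizon positive.\<close>
  define m where "m = 1 + T Robot1 1 + T Robot1 (-1) + T Robot2 1 + T Robot2 (-1)"
  have "T k \<rho> \<le> m" if "\<rho> \<in> {1, -1}" for k \<rho>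
    using T[of 1 Robot1] T[of "-1" Robot1] T[of 1 Robot2] T[of "-1" Robot2] that
    by (cases k) (auto simp: m_def)
  moreover have "m > 0"
    using T[of 1 Robot1] T[of "-1" Robot1] T[of 1 Robot2] T[of "-1" Robot2] by (simp add: m_def)
  moreover obtain k \<rho> where k: "\<rho> \<in> {1, -1}" "search k (b * m / b) = \<rho> * (b * m)"
    using search_extreme[of "b * m"] b \<open>m > 0\<close> mult_pos_pos by blast
  ultimately have "search k (T k \<rho>) = \<rho> * b * T k \<rho>"
    using search_straight[OF k(2) k(1), of "T k \<rho>"] T b by simp
  then show False
    using T k by blast
qed

text \<open>If the exit lies behind the robot \<open>k\<close> that never turns, then \<open>k\<close> can come back in time only if
  the other robot finds the exit at time \<open>d / b\<close>.\<close>

lemma search_other_robot: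
  assumes k: "\<forall>t\<ge>0. search k t = \<rho> * b * t" "\<rho> \<in> {1, -1}" and "j \<noteq> k" "0 \<le> t"
  shows "search j t = - \<rho> * b * t"
proof (cases "t = 0")
  case True
  then show ?thesis by (simp add: search_start)
next
  case False
  define d where "d = b * t"
  have d: "d > 0" using False assms b by (simp add: d_def)
  define e where "e = - \<rho> * d"
  have e: "e \<noteq> 0" "\<bar>e\<bar> = d" using k(2) d by (auto simp: e_def)
  define \<tau> where "\<tau> = discovery e"
  have \<tau>: "0 \<le> \<tau>" "d \<le> b * \<tau>"
    using discovery_bounds[of e] e by (auto simp: \<tau>_def)
  have Ak: "A e k \<tau> = \<rho> * b * \<tau>"
    using eq_search_until_discovery[of e \<tau> k] k \<tau> e by (simp add: \<tau>_def)
  have "\<bar>e - \<rho> * b * \<tau>\<bar> = d + b * \<tau>"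
    using k(2) d \<tau> by (auto simp: e_def)
  \<comment> \<open>Robot \<open>k\<close> must return across the origin. Together with the bound
    \<open>3 * d\<close> on \<open>b\<close> times its arrival time, this leaves
    \<open>b * \<tau> \<le> d\<close>.\<close>
  then have "d + b * \<tau> \<le> b * (arrival_time A e k - \<tau>)"
    using distance_le[of e \<tau> "arrival_time A e k" k] arrival_attained(2)[of e k] e \<tau> Ak
      discovery_le[of e k] by (simp add: \<tau>_def)
  then have "b * \<tau> \<le> d"
    using arrival_le[of e k] e by (simp add: algebra_simps)
  then have "\<tau> = t"
    using \<tau> b by (simp add: d_def)
  obtain i where i: "arrival_time A e i = \<tau>"
    unfolding \<tau>_def by (rule discovery_finder)
  have "i \<noteq> k"
  proof
    assume "i = k"
    then have "e = \<rho> * b * \<tau>"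
      using Ak arrival_attained(2)[of e i] i e by simp
    then show False
      using k(2) d by (auto simp: e_def d_def \<open>\<tau> = t\<close>)
  qed
  then have "i = j"
    using \<open>j \<noteq> k\<close> by (metis robot.exhaust)
  then have "search j t = e"
    using eq_search_until_discovery[of e \<tau> j] arrival_attained(2)[of e j] i e \<tau>
    by (simp add: \<tau>_def flip: \<open>\<tau> = t\<close>)
  then show ?thesis by (simp add: e_def d_def)
qed

text \<open>Either robot may be the one known never to turn. Since \<sigma> is the direction of
  \<open>Robot1\<close>, it is \<open>- \<rho>\<close> if that robot is
  \<open>Robot2\<close>.\<close>

lemma search_opposite:
  obtains \<sigma> where "\<sigma> \<in> {1, -1}" "\<forall>i. \<forall>t\<ge>0. search i t = direction \<sigma> i * b * t"
proof -
  obtain k \<rho> where \<rho>: "\<rho> \<in> {1, -1}" and k: "\<forall>t\<ge>0. search k t = \<rho> * b * t"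
    using search_eternal_robot by blast
  note j = search_other_robot[OF k \<rho>]
  show ?thesis
  proof (cases k)
    case Robot1
    show ?thesis
    proof (rule that)
      show "\<rho> \<in> {1, -1}" by (rule \<rho>)
      show "\<forall>i. \<forall>t\<ge>0. search i t = direction \<rho> i * b * t"
      proof (intro allI impI)
        fix i t
        assume "0 \<le> (t :: real)"
        then show "search i t = direction \<rho> i * b * t"
          using k[rule_format, of t] j[of Robot2 t] by (cases i) (simp_all add: Robot1)
      qed
    qed
  next
    case Robot2
    show ?thesis
    proof (rule that)
      show "\<forall>i. \<forall>t\<ge>0. search i t = direction (- \<rho>) i * b * t"
      proof (intro allI impI)
        fix i t
        assume "0 \<le> (t :: real)"
        then show "search i t = direction (- \<rho>) i * b * t"
          using k[rule_format, of t] j[of Robot1 t] by (cases i) (simp_all add: Robot2)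
      qed
    qed (use \<rho> in auto)
  qed
qed

section \<open>The forced motion once the two search directions are fixed\<close>

context
  fixes \<sigma> :: real
  assumes \<sigma>: "\<sigma> \<in> {1, -1}" and search: "\<forall>i. \<forall>t\<ge>0. search i t = direction \<sigma> i * b * t"
begin

lemma outward:
  assumes "e \<noteq> 0" "0 \<le> t" "t \<le> \<bar>e\<bar> / b"
  shows "A e i t = direction \<sigma> i * b * t"
proof -
  have "b * t \<le> \<bar>e\<bar>"
    using assms b by (simp add: field_simps)
  then show ?thesis
    using eq_search[of e t i] not_found_early[of e t] search assms by simp
qed

lemma finder_arrival:
  assumes "e \<noteq> 0" "direction \<sigma> i = sgn e"
  shows "arrival_time A e i = \<bar>e\<bar> / b"
proof (rule antisym)
  show "arrival_time A e i \<le> \<bar>e\<bar> / b"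
    using outward[of e "\<bar>e\<bar> / b" i] assms b by (intro arrival_lower) (auto simp: sgn_mult_abs)
  show "\<bar>e\<bar> / b \<le> arrival_time A e i"
    using arrival_ge[of e i] assms b by (simp add: field_simps)
qed

context
  fixes e :: real and i
  assumes e: "e \<noteq> 0" "direction \<sigma> i \<noteq> sgn e"
begin

lemma turning_point: "A e i (\<bar>e\<bar> / b) = - e"
proof -
  have "direction \<sigma> i = - sgn e"
    using e direction_cases[OF \<sigma>, of i] by (auto simp: sgn_if split: if_splits)
  then show ?thesis
    using outward[of e "\<bar>e\<bar> / b" i] e b by (simp add: sgn_mult_abs)
qed

text \<open>At time \<open>\<bar>e\<bar> / b\<close> this robot is at \<open>-e\<close>, so the
  speed bound gives the lower estimate and the evacuation deadline the upper one.\<close>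

lemma other_arrival: "arrival_time A e i = 3 * \<bar>e\<bar> / b"
proof -
  let ?a = "arrival_time A e i"
  have "\<bar>e\<bar> / b \<le> ?a"
    using arrival_ge[of e i] e b by (simp add: field_simps)
  then have "\<bar>e - (- e)\<bar> \<le> b * (?a - \<bar>e\<bar> / b)"
    using distance_le[of e "\<bar>e\<bar> / b" ?a i] arrival_attained(2)[of e i] turning_point e b by simp
  then have "3 * \<bar>e\<bar> \<le> b * ?a"
    using b by (simp add: right_diff_distrib)
  then have "b * ?a = 3 * \<bar>e\<bar>"
    using arrival_le[of e i] e by simp
  then show ?thesis using b by (simp add: field_simps)
qed

text \<open>A distance \<open>2 * \<bar>e\<bar>\<close> has to be covered in time
  \<open>2 * \<bar>e\<bar> / b\<close>, so \<open>lipschitz_straight\<close> applies between the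
  turning point and the arrival.\<close>

lemma homeward:
  assumes t: "\<bar>e\<bar> / b \<le> t" "t \<le> 3 * \<bar>e\<bar> / b"
  shows "A e i t = - e + sgn e * b * (t - \<bar>e\<bar> / b)"
proof -
  have "A e i (3 * \<bar>e\<bar> / b) = e"
    using arrival_attained(2)[of e i] other_arrival e by simp
  moreover have "sgn e \<in> {1, -1}"
    using e by (auto simp: sgn_if)
  moreover have "e - (- e) = sgn e * b * (3 * \<bar>e\<bar> / b - \<bar>e\<bar> / b)"
    using b by (simp add: right_diff_distrib sgn_if)
  ultimately show ?thesis
    using lipschitz_straight[OF lipschitz, of e "\<bar>e\<bar> / b" t "3 * \<bar>e\<bar> / b" "sgn e" i]
      turning_point e t b by simp
qed

end

end

section \<open>Evacuation time and a lower bound on the energy\<close>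

lemma evac_time_eq:
  assumes "e \<noteq> 0"
  shows "evac_time A e = 3 * \<bar>e\<bar> / b"
proof -
  obtain \<sigma> where \<sigma>: "\<sigma> \<in> {1, -1}"
    and search: "\<forall>i. \<forall>t\<ge>0. search i t = direction \<sigma> i * b * t"
    using search_opposite by blast
  note a = finder_arrival[OF \<sigma> search assms] other_arrival[OF \<sigma> search assms]
  have "\<bar>e\<bar> / b \<le> 3 * \<bar>e\<bar> / b"
    using b by (simp add: field_simps)
  then show ?thesis
    using a[of Robot1] a[of Robot2] direction_opposite[OF \<sigma> assms]
    by (cases "direction \<sigma> Robot1 = sgn e") (simp_all add: evac_time_def)
qed

text \<open>Cut at time \<open>\<bar>e\<bar> / b\<close>: both outward runs and the homeward run are
  affine with forced energy, in total 1 + 1 + 2 times \<open>b\<^sup>2 * \<bar>e\<bar>\<close>. The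
  finder's motion after discovery is not determined; only nonnegativity of its energy
  enters.\<close>

lemma evac_energy_ge:
  assumes "e \<noteq> 0"
  shows "ennreal (4 * b\<^sup>2 * \<bar>e\<bar>) \<le> evac_energy A e"
proof -
  obtain \<sigma> where \<sigma>: "\<sigma> \<in> {1, -1}"
    and search: "\<forall>i. \<forall>t\<ge>0. search i t = direction \<sigma> i * b * t"
    using search_opposite by blast
  note out = outward[OF \<sigma> search assms] and homeward = homeward[OF \<sigma> search assms]
  define T where "T = \<bar>e\<bar> / b"
  have "0 \<le> T"
    using b by (simp add: T_def)
  then have T: "0 \<le> T" "T \<le> 3 * T" "3 * T = 3 * \<bar>e\<bar> / b" "b * T = \<bar>e\<bar>"
    using b by (linarith, linarith, simp_all add: T_def)
  have split: "b\<^sup>2 * \<bar>e\<bar> \<le> E \<and> (direction \<sigma> i \<noteq> sgn e \<longrightarrow> 3 * b\<^sup>2 * \<bar>e\<bar> \<le> E)"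
    if used: "uses_energy (A e i) 0 (3 * T) E" for E i
  proof -
    obtain F G where F: "uses_energy (A e i) 0 T F" and G: "uses_energy (A e i) T (3 * T) G"
      and E: "E = F + G"
      using uses_energy_split[OF used, of T] T by auto
    have "F = b\<^sup>2 * (b * (T - 0))"
      using out b direction_cases[OF \<sigma>]
      by (intro uses_energy_affine_unique[OF F, of b "direction \<sigma> i" 0]) (auto simp: T_def)
    moreover have "G = b\<^sup>2 * (b * (3 * T - T))" if "direction \<sigma> i \<noteq> sgn e"
    proof (rule uses_energy_affine_unique[OF G b])
      show "sgn e \<in> {1, -1}"
        using assms by (auto simp: sgn_if)
      show "\<forall>t\<in>{T..3 * T}. A e i t = (- e - sgn e * b * T) + sgn e * b * t"
        using homeward[OF that] T by (auto simp: algebra_simps T_def)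
    qed
    moreover have "b\<^sup>2 * (b * (3 * T - T)) = 2 * b\<^sup>2 * \<bar>e\<bar>"
      using T(4) by (simp add: algebra_simps)
    ultimately show ?thesis
      using E uses_energy_nonneg[OF G] T(4) by auto
  qed
  \<comment> \<open>If no decomposition exists, the infimum is infinite and the bound still
    holds.\<close>
  have low: "ennreal m \<le> energy (A e i) 0 (3 * T)"
    if "\<And>E. uses_energy (A e i) 0 (3 * T) E \<Longrightarrow> m \<le> E" for m i
    unfolding energy_def using that by (auto intro!: Inf_greatest ennreal_leI)
  have "ennreal (b\<^sup>2 * \<bar>e\<bar>) + ennreal (3 * b\<^sup>2 * \<bar>e\<bar>) \<le> evac_energy A e"
  proof (cases "direction \<sigma> Robot1 = sgn e")
    case True
    then have "direction \<sigma> Robot2 \<noteq> sgn e"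
      using \<sigma> by auto
    then show ?thesis
      unfolding evac_energy_def evac_time_eq[OF assms] T(3)[symmetric]
      using split by (intro add_mono low) auto
  next
    case False
    then show ?thesis
      unfolding evac_energy_def evac_time_eq[OF assms] T(3)[symmetric]
      using split by (subst add.commute) (intro add_mono low, auto)
  qed
  then show ?thesis
    by (simp add: mult.commute mult.left_commute flip: ennreal_plus)
qed

end

section \<open>The naive algorithm\<close>

lemma naive_lipschitz:
  assumes "b > 0" "\<sigma> \<in> {1, -1}" "e \<noteq> 0"
  shows "b-lipschitz_on {0..} (naive \<sigma> b b e i)"
proof -
  define T where "T = \<bar>e\<bar> / b"
  \<comment> \<open>This is the motion divided by \<open>b\<close>, piecewise linear with slopes 0,
    1 and -1. The returning robot crosses the origin at time \<open>2 * T\<close>, which gives the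
    factor \<open>t - 2 * T\<close>.\<close>
  define f where "f t = (if t \<le> T then direction \<sigma> i * t else if direction \<sigma> i = sgn e then sgn e * T
    else if t - T \<le> 2 * T then sgn e * (t - 2 * T) else sgn e * T)" for t
  have T: "T > 0" "\<bar>e\<bar> = b * T" "e = b * (sgn e * T)"
    using assms by (auto simp: T_def sgn_if)
  have naive: "naive \<sigma> b b e i t = b * f t" for t
  proof -
    have "b * (t - T) \<le> 2 * (b * T) \<longleftrightarrow> t - T \<le> 2 * T"
      using \<open>b > 0\<close> by (simp flip: mult_le_cancel_left_pos[of b "t - T" "2 * T"] add: algebra_simps)
    moreover have "- e + sgn e * b * (t - T) = b * (sgn e * (t - 2 * T))"
      by (subst (1) T(3)) (simp add: algebra_simps)
    ultimately show ?thesis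
      unfolding naive_def T_def[symmetric] f_def using T by auto
  qed
  have "\<bar>f s - f t\<bar> \<le> \<bar>s - t\<bar>" if "0 \<le> s" "0 \<le> t" for s t
  proof -
    have "direction \<sigma> i = 1 \<or> direction \<sigma> i = -1" "sgn e = 1 \<or> sgn e = -1"
      using direction_cases[OF assms(2), of i] assms(3) by (auto simp: sgn_if)
    then show ?thesis
      unfolding f_def using T(1) that by (elim disjE) (auto simp: abs_if)
  qed
  then show ?thesis
    using \<open>b > 0\<close> by (intro lipschitz_onI)
      (auto simp: naive dist_real_def abs_mult simp flip: right_diff_distrib)
qed

lemma naive_out:
  "t \<le> \<bar>e\<bar> / b \<Longrightarrow> naive \<sigma> b b e i t = direction \<sigma> i * b * t"
  by (simp add: naive_def)

lemma naive_finder: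
  assumes "b > 0" "direction \<sigma> i = sgn e" "\<bar>e\<bar> / b \<le> t"
  shows "naive \<sigma> b b e i t = e"
  using assms by (cases "t = \<bar>e\<bar> / b") (auto simp: naive_def sgn_mult_abs)

lemma naive_back:
  assumes "b > 0" "\<sigma> \<in> {1, -1}" "e \<noteq> 0" "direction \<sigma> i \<noteq> sgn e" "\<bar>e\<bar> / b \<le> t" "t \<le> 3 * \<bar>e\<bar> / b"
  shows "naive \<sigma> b b e i t = - e + sgn e * b * (t - \<bar>e\<bar> / b)"
proof (cases "t = \<bar>e\<bar> / b")
  case True
  have "direction \<sigma> i = - sgn e"
    using assms direction_cases[OF assms(2), of i] by (auto simp: sgn_if split: if_splits)
  then show ?thesis
    using True assms by (simp add: naive_def sgn_mult_abs)
next
  case False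
  have "b * (t - \<bar>e\<bar> / b) \<le> 2 * \<bar>e\<bar>"
    using assms by (simp add: field_simps)
  then show ?thesis
    using False assms by (simp add: naive_def)
qed

lemma naive_end:
  assumes "b > 0" "\<sigma> \<in> {1, -1}" "e \<noteq> 0" "3 * \<bar>e\<bar> / b \<le> t"
  shows "naive \<sigma> b b e i t = e"
proof (cases "direction \<sigma> i = sgn e")
  case True
  moreover have "\<bar>e\<bar> / b \<le> 3 * \<bar>e\<bar> / b"
    using assms by (simp add: field_simps)
  ultimately show ?thesis
    using assms by (intro naive_finder) auto
next
  case False
  show ?thesis
  proof (cases "t = 3 * \<bar>e\<bar> / b")
    case True
    have "\<bar>e\<bar> / b \<le> 3 * \<bar>e\<bar> / b"
      using assms by (simp add: field_simps)
    then show ?thesis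
      using naive_back[of b \<sigma> e i t] False True assms by (simp add: right_diff_distrib sgn_if)
  next
    case neq: False
    then have "\<not> t \<le> \<bar>e\<bar> / b" "\<not> b * (t - \<bar>e\<bar> / b) \<le> 2 * \<bar>e\<bar>"
      using assms by (auto simp: field_simps)
    then show ?thesis
      using False by (simp add: naive_def)
  qed
qed

lemma naive_feasible:
  assumes "b > 0" "b * c = 3" "\<sigma> \<in> {1, -1}"
  shows "feasible b c (naive \<sigma> b b)"
proof -
  let ?N = "naive \<sigma> b b"
  \<comment> \<open>One robot stands on \<open>e\<close> at time \<open>\<bar>e\<bar> / b\<close>.
    An exit not found before \<open>t\<close> therefore leaves both robots in the outward phase,
    whose formula does not depend on the exit.\<close>
  have early: "t \<le> \<bar>e\<bar> / b" if "e \<noteq> 0" "\<not> found_before ?N e t" for e t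
  proof (rule ccontr)
    assume "\<not> t \<le> \<bar>e\<bar> / b"
    moreover have "\<exists>i. direction \<sigma> i = sgn e"
      using direction_opposite[OF assms(3) that(1)] by blast
    then obtain i where "direction \<sigma> i = sgn e" ..
    then have "?N e i (\<bar>e\<bar> / b) = e"
      using naive_finder assms by blast
    ultimately have "found_before ?N e t"
      using assms(1) unfolding found_before_def by (intro exI[of _ i] bexI[of _ "\<bar>e\<bar> / b"]) auto
    then show False using that by blast
  qed
  have "is_algorithm ?N"
    unfolding is_algorithm_def
  proof (intro conjI allI impI)
    fix e :: real and i
    assume "e \<noteq> 0"
    then show "?N e i 0 = 0" "continuous_on {0..} (?N e i)"
      using assms lipschitz_on_continuous_on[OF naive_lipschitz] by (auto simp: naive_out)
  next
    fix e e' t :: real and i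
    assume "e \<noteq> 0 \<and> e' \<noteq> 0 \<and> 0 \<le> t \<and> \<not> found_before ?N e t \<and> \<not> found_before ?N e' t"
    then show "?N e i t = ?N e' i t"
      using early by (simp add: naive_out)
  qed
  have "speed_at_most b ?N"
    using naive_lipschitz assms by (auto simp: speed_at_most_def)
  have exit: "reaches_exit ?N e i \<and> arrival_time ?N e i \<le> c * \<bar>e\<bar>" if "e \<noteq> 0" for e i
  proof -
    have "c * \<bar>e\<bar> = 3 * \<bar>e\<bar> / b"
      using assms(1) by (simp add: field_simps flip: assms(2))
    moreover have "0 \<le> 3 * \<bar>e\<bar> / b" "?N e i (3 * \<bar>e\<bar> / b) = e"
      using assms that naive_end by auto
    ultimately show ?thesis
      unfolding reaches_exit_def arrival_time_def
      by (auto intro!: cInf_lower bdd_belowI[of _ 0])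
  qed
  have "(\<forall>i. reaches_exit ?N e i) \<and> evac_time ?N e \<le> c * d"
    if "0 < d" "e \<in> {d, - d}" for d e
  proof -
    have "e \<noteq> 0" "\<bar>e\<bar> = d"
      using that by auto
    then show ?thesis
      using exit[of e] by (auto simp: evac_time_def)
  qed
  with \<open>is_algorithm ?N\<close> \<open>speed_at_most b ?N\<close> show ?thesis
    unfolding feasible_def by blast
qed

text \<open>One explicit decomposition per robot bounds the infimum: an outward run, then a rest for
  the finder or a homeward run for the other robot.\<close>

lemma naive_evac_energy_le:
  assumes "b > 0" "b * c = 3" "\<sigma> \<in> {1, -1}" "e \<noteq> 0"
  shows "evac_energy (naive \<sigma> b b) e \<le> ennreal (4 * b\<^sup>2 * \<bar>e\<bar>)"
proof -
  let ?N = "naive \<sigma> b b"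
  interpret tight_feasible b c ?N
    using assms naive_feasible by unfold_locales auto
  define T where "T = \<bar>e\<bar> / b"
  have "0 \<le> T"
    using b by (simp add: T_def)
  then have T: "0 \<le> T" "T \<le> 3 * T" "3 * T = 3 * \<bar>e\<bar> / b" "b * T = \<bar>e\<bar>"
    using b by (linarith, linarith, simp_all add: T_def)
  have out: "uses_energy (?N e i) 0 T (b\<^sup>2 * (b * (T - 0)))" for i
    using T b direction_cases[OF assms(3), of i]
    by (intro uses_energy_affine[where a = 0 and \<rho> = "direction \<sigma> i"]) (auto simp: naive_out T_def)
  have "uses_energy (?N e i) T (3 * T) 0" if "direction \<sigma> i = sgn e" for i
    using T b naive_finder[OF b that] by (intro uses_energy.rest) (auto simp: T_def)
  from uses_energy.add[OF out this]
  have finder: "energy (?N e i) 0 (3 * T) \<le> ennreal (b\<^sup>2 * \<bar>e\<bar>)" if "direction \<sigma> i = sgn e" for i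
    unfolding energy_def using that T(4) by (intro Inf_lower) auto
  have "uses_energy (?N e i) T (3 * T) (b\<^sup>2 * (b * (3 * T - T)))" if "direction \<sigma> i \<noteq> sgn e" for i
  proof (rule uses_energy_affine[OF T(2) b])
    show "sgn e \<in> {1, -1}"
      using assms by (auto simp: sgn_if)
    show "\<forall>t\<in>{T..3 * T}. ?N e i t = (- e - sgn e * b * T) + sgn e * b * t"
      using naive_back[OF b assms(3,4) that] T by (auto simp: algebra_simps T_def)
  qed
  from uses_energy.add[OF out this]
  have "uses_energy (?N e i) 0 (3 * T) (3 * b\<^sup>2 * \<bar>e\<bar>)" if "direction \<sigma> i \<noteq> sgn e" for i
    using that by (simp add: algebra_simps flip: T(4))
  then have other: "energy (?N e i) 0 (3 * T) \<le> ennreal (3 * b\<^sup>2 * \<bar>e\<bar>)"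
    if "direction \<sigma> i \<noteq> sgn e" for i
    unfolding energy_def using that by (intro Inf_lower) auto
  have "evac_energy ?N e \<le> ennreal (b\<^sup>2 * \<bar>e\<bar>) + ennreal (3 * b\<^sup>2 * \<bar>e\<bar>)"
  proof (cases "direction \<sigma> Robot1 = sgn e")
    case True
    then have "direction \<sigma> Robot2 \<noteq> sgn e"
      using assms(3) by auto
    with True show ?thesis
      unfolding evac_energy_def evac_time_eq[OF assms(4)] T(3)[symmetric]
      by (intro add_mono finder other)
  next
    case False
    then have "direction \<sigma> Robot2 = sgn e"
      using assms(3,4) by (auto simp: sgn_if split: if_splits)
    with False show ?thesis
      unfolding evac_energy_def evac_time_eq[OF assms(4)] T(3)[symmetric]
      by (subst (2) add.commute) (intro add_mono finder other)
  qed
  then show ?thesis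
    by (simp add: mult.commute mult.left_commute flip: ennreal_plus)
qed

lemma naive_arrival:
  assumes "b > 0" "b * c = 3" "\<sigma> \<in> {1, -1}" "e \<noteq> 0"
  shows "arrival_time (naive \<sigma> b b) e i = (if direction \<sigma> i = sgn e then \<bar>e\<bar> / b else 3 * \<bar>e\<bar> / b)"
proof -
  interpret tight_feasible b c "naive \<sigma> b b"
    using assms naive_feasible by unfold_locales auto
  obtain \<tau> where \<tau>: "\<tau> \<in> {1, -1}"
    and search: "\<forall>i. \<forall>t\<ge>0. search i t = direction \<tau> i * b * t"
    using search_opposite by blast
  \<comment> \<open>\<open>search_opposite\<close> yields some sign; the position of
    \<open>Robot1\<close> at time \<open>1 / b\<close> with the exit at 1 identifies it.\<close>
  have "\<tau> = \<sigma>"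
    using outward[OF \<tau> search, of 1 "1 / b" Robot1] naive_out[of "1 / b" 1 b \<sigma> Robot1] b by simp
  then show ?thesis
    using finder_arrival[OF \<tau> search assms(4)] other_arrival[OF \<tau> search assms(4)] by simp
qed

section \<open>Uniqueness of the naive algorithm\<close>

context tight_feasible
begin

text \<open>Both motions are outward until \<open>\<bar>e\<bar> / b\<close>. After that only the
  robot that heads away from the exit has not arrived, and its way home is forced.\<close>

lemma same_as_naive:
  obtains \<sigma> where "\<sigma> \<in> {1, -1}" "same_until_exit A (naive \<sigma> b b)"
proof -
  obtain \<sigma> where \<sigma>: "\<sigma> \<in> {1, -1}"
    and search: "\<forall>i. \<forall>t\<ge>0. search i t = direction \<sigma> i * b * t"
    using search_opposite by blast
  note out = outward[OF \<sigma> search] and finder = finder_arrival[OF \<sigma> search]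
    and other = other_arrival[OF \<sigma> search] and homeward = homeward[OF \<sigma> search]
  have "A e i t = naive \<sigma> b b e i t" if "e \<noteq> 0" "0 \<le> t" "t \<le> arrival_time A e i" for e i t
  proof (cases "t \<le> \<bar>e\<bar> / b")
    case True
    then show ?thesis using out naive_out that by simp
  next
    case False
    then have "direction \<sigma> i \<noteq> sgn e"
      using finder that by force
    then show ?thesis
      using False that homeward[of e i t] other naive_back[OF b \<sigma>, of e i t] by simp
  qed
  then have "same_until_exit A (naive \<sigma> b b)"
    using naive_arrival[OF b bc \<sigma>] finder other by (auto simp: same_until_exit_def)
  then show ?thesis using that \<sigma> by blast
qed

text \<open>Feasibility does not make a robot stay at the exit, so agreement at all later times
  needs the convention that robots halt there.\<close>

lemma eq_naive_if_halts:
  assumes "halts_at_exit A" "\<sigma> \<in> {1, -1}" "same_until_exit A (naive \<sigma> b b)" "e \<noteq> 0" "0 \<le> t"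
  shows "A e i t = naive \<sigma> b b e i t"
proof (cases "t \<le> arrival_time A e i")
  case True
  then show ?thesis using assms by (auto simp: same_until_exit_def)
next
  case False
  then have "A e i t = e"
    using assms reaches by (auto simp: halts_at_exit_def)
  moreover have "arrival_time (naive \<sigma> b b) e i \<le> t"
    using assms False by (auto simp: same_until_exit_def)
  then have "naive \<sigma> b b e i t = e"
    using naive_arrival[OF b bc assms(2,4), of i] naive_finder[OF b] naive_end[OF b assms(2,4)]
    by (auto split: if_splits)
  ultimately show ?thesis by simp
qed

end

theorem theorem1:
  fixes b c :: real
  assumes "b > 0" and "c > 0" and "b * c = 3"
  shows "(\<forall>\<sigma>\<in>{1, -1}. feasible b c (naive \<sigma> b b)) \<and>
    (\<forall>A. feasible b c A \<longrightarrow>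
       (\<exists>\<sigma>\<in>{1, -1}. same_until_exit A (naive \<sigma> b b) \<and>
          (halts_at_exit A \<longrightarrow> (\<forall>e i t. e \<noteq> 0 \<and> 0 \<le> t \<longrightarrow> A e i t = naive \<sigma> b b e i t)))) \<and>
    (\<forall>\<sigma>\<in>{1, -1}. optimal b c (naive \<sigma> b b)) \<and>
    (\<forall>\<sigma>\<in>{1, -1}. \<forall>d>0. \<forall>e\<in>{d, -d}. evac_energy (naive \<sigma> b b) e = ennreal (4 * b\<^sup>2 * d))"
proof -
  have tight: "tight_feasible b c A" if "feasible b c A" for A
    using assms that by unfold_locales
  note naive = naive_feasible[OF assms(1,3)]
  have unique: "\<exists>\<sigma>\<in>{1, -1}. same_until_exit A (naive \<sigma> b b) \<and>
      (halts_at_exit A \<longrightarrow> (\<forall>e i t. e \<noteq> 0 \<and> 0 \<le> t \<longrightarrow> A e i t = naive \<sigma> b b e i t))"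
    if A: "feasible b c A" for A
  proof -
    obtain \<sigma> where \<sigma>: "\<sigma> \<in> {1, -1}" "same_until_exit A (naive \<sigma> b b)"
      using tight_feasible.same_as_naive[OF tight[OF A]] by blast
    then show ?thesis
      using tight_feasible.eq_naive_if_halts[OF tight[OF A] _ \<sigma>] by blast
  qed
  \<comment> \<open>The lower bound for all feasible algorithms applies to the naive one and meets
    its explicit upper bound; optimality follows from the same lower bound.\<close>
  have energy: "evac_energy (naive \<sigma> b b) e = ennreal (4 * b\<^sup>2 * \<bar>e\<bar>)"
    if "\<sigma> \<in> {1, -1}" "e \<noteq> 0" for \<sigma> e
    using naive_evac_energy_le[OF assms(1,3) that]
      tight_feasible.evac_energy_ge[OF tight[OF naive[OF that(1)]] that(2)]
    by (rule antisym)
  have "optimal b c (naive \<sigma> b b)" if \<sigma>: "\<sigma> \<in> {1, -1}" for \<sigma>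
    unfolding optimal_def
  proof (intro conjI allI impI ballI naive \<sigma>)
    fix B d and e :: real
    assume B: "feasible b c B" and "0 < d" "e \<in> {d, -d}"
    then have "e \<noteq> 0" by auto
    then show "evac_energy (naive \<sigma> b b) e \<le> evac_energy B e"
      using energy[OF \<sigma>] tight_feasible.evac_energy_ge[OF tight[OF B]] by simp
  qed
  moreover have "evac_energy (naive \<sigma> b b) e = ennreal (4 * b\<^sup>2 * d)"
    if "\<sigma> \<in> {1, -1}" "d > 0" "e \<in> {d, -d}" for \<sigma> d e
    using energy[OF that(1), of e] that(2,3) by auto
  ultimately show ?thesis
    using naive unique by blast
qed

end
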